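(* Let $S$ be a type-space functor with enough countable models (i.e. $S_{\mathcal W}$ dense in $S_\omega$) such that each $S_n$ is separable and metrizable. If $S_\omega$ is completely weakly $\alpha$-favourable, then $S$ has the game omitting types property.
   Context: Regard each natural number $n$ as the set $\{0,\dots,n-1\}$. A type-space functor $S$ assigns to each $n<\omega$ a topological space $S_n$ and to each function $f:n\to m$ a continuous open map $Sf:S_m\to S_n$ such that $S(g\circ f)=(Sf)\circ(Sg)$, $S(\mathrm{id}_n)=\mathrm{id}_{S_n}$, and a weak amalgamation condition holds (for every $m$, $p\in S_m$, $q\in(Si_m)^{-1}(\{p\})$ and non-empty open $U\subseteq(Si_m)^{-1}(\{p\})$ there is $r\in S_{m+2}$ with $(Si_{m+1})(r)=q$ and $(Sd_m)(r)\in U$, where $i_k:k\to k+1$ is the inclusion and $d_m(j)=j$ for $j<m$, $d_m(m)=m+1$). For $n\le m$, $\iota_{n,m}:n\to m$ is the inclusion. $S_\omega=\{(a_n)_{n<\omega}\in\prod_n S_n : a_n=(S\iota_{n,m})(a_m)\ \forall n<m\}$ with the product subspace topology; for $f:n\to\omega$, $Sf:S_\omega\to S_n$ is $(Sf)((a_j)_j)=(Sf')(a_m)$ where $f[n]\subseteq m$ and $f':n\to m$ agrees with $f$. A model of size $\omega$ for $S$ is a function $M$ on $[\omega]^{<\omega}$ such that for every $A=\{a_0<\dots<a_{n-1}\}\in[\omega]^n$: (1) $M(A)\in S_n$; (2) if $B=\{b_0<\dots<b_{m-1}\}\supseteq A$ and $g:n\to m$ satisfies $a_i=b_{g(i)}$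 then $M(A)=(Sg)(M(B))$; (3) for every $m\ge n$ and open $U\subseteq(S\iota_{n,m})^{-1}(\{M(A)\})$ there are $B=\{b_0<\dots<b_{m-1}\}\in[\omega]^m$, $B\supseteq A$, and a permutation $g$ of $m$ with $a_i=b_{g(i)}$ for $i<n$ and $(Sg)(M(B))\in U$. For $\sigma\in S_\omega$, $M_\sigma(A)=(Sf_A)(\sigma)$ where $f_A$ enumerates $A$ increasingly; $S_{\mathcal W}=\{\sigma\in S_\omega: M_\sigma\text{ is a model}\}$. A partial $\omega$-type is a closed subset of $S_\omega$. For a partial $\omega$-type $C$, a set $F\subseteq S_\omega$ is omissible in a model realizing $C$ if there is $\sigma\in S_{\mathcal W}\cap C$ with $\sigma\notin F$. The omitting types game on $C$: players REALIZE and OMIT alternately choose partial $\omega$-types $F_0\subseteq F_1\subseteq\cdots$, REALIZE first, each $F_i$ omissible in a model realizing $C$; OMIT wins if $\bigcup_n F_n$ is omissible in a model realizing $C$. $S$ has the game omitting types property if OMIT has a winning strategy in this game for every partial $\omega$-type $C$. The Banach–Mazur game on a space $Y$: EMPTY and NONEMPTY alternately choose non-empty open sets $O_0\supseteq O_1\supseteq\cdots$, EMPTY first; NONEMPTY wins if $\bigcap_n O_n\ne\emptyset$. $Y$ is weakly $\alpha$-favourable if NONEMPTY has a winning strategy; completely weakly $\alpha$-favourable if every closed subspace is weakly $\alpha$-favourable. *)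

theory Defs
  imports "HOL-Analysis.Analysis"
begin

section \<open>Type-space functors\<close>

text \<open>
  The natural number \<open>n\<close>, viewed as a set, is \<open>{..<n}\<close>, and a function \<open>f : n \<rightarrow> m\<close> is an element of
  the extensional function space \<open>{..<n} \<rightarrow>\<^sub>E {..<m}\<close>, so that functions \<open>n \<rightarrow> m\<close> are represented
  uniquely. A type-space functor consists of the spaces \<open>S n\<close> and of the maps \<open>T n m f\<close> from \<open>S m\<close>
  to \<open>S n\<close> (the map \<open>Sf\<close> for \<open>f : n \<rightarrow> m\<close>). All \<open>S n\<close> live on one type, with varying carriers
  \<open>topspace (S n)\<close>.
\<close>

type_synonym 'a type_maps = "nat \<Rightarrow> nat \<Rightarrow> (nat \<Rightarrow> nat) \<Rightarrow> 'a \<Rightarrow> 'a"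

text \<open>The inclusion of \<open>n\<close> into any \<open>m \<ge> n\<close>; as a set of pairs it does not depend on \<open>m\<close>.\<close>

definition incl :: "nat \<Rightarrow> nat \<Rightarrow> nat" where
  "incl n = (\<lambda>j\<in>{..<n}. j)"

definition skip_map :: "nat \<Rightarrow> nat \<Rightarrow> nat" where
  "skip_map m = (\<lambda>j\<in>{..<m + 1}. if j < m then j else m + 1)"

text \<open>The fibre \<open>(S\<iota>)\<inverse>({p}) \<subseteq> S m\<close> for the inclusion \<open>\<iota> : n \<rightarrow> m\<close>, as a subspace.\<close>

definition fibre_space ::
  "(nat \<Rightarrow> 'a topology) \<Rightarrow> 'a type_maps \<Rightarrow> nat \<Rightarrow> nat \<Rightarrow> 'a \<Rightarrow> 'a topology" where
  "fibre_space S T n m p = subtopology (S m) {q \<in> topspace (S m). T n m (incl n) q = p}"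

definition weak_amalgamation :: "(nat \<Rightarrow> 'a topology) \<Rightarrow> 'a type_maps \<Rightarrow> bool" where
  "weak_amalgamation S T \<longleftrightarrow>
     (\<forall>m. \<forall>p \<in> topspace (S m). \<forall>q \<in> topspace (fibre_space S T m (m + 1) p).
        \<forall>U. openin (fibre_space S T m (m + 1) p) U \<and> U \<noteq> {} \<longrightarrow>
          (\<exists>r \<in> topspace (S (m + 2)).
             T (m + 1) (m + 2) (incl (m + 1)) r = q \<and>
             T (m + 1) (m + 2) (skip_map m) r \<in> U))"

definition type_space_functor :: "(nat \<Rightarrow> 'a topology) \<Rightarrow> 'a type_maps \<Rightarrow> bool" where
  "type_space_functor S T \<longleftrightarrow>
     (\<forall>n m. \<forall>f \<in> {..<n} \<rightarrow>\<^sub>E {..<m}.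
        continuous_map (S m) (S n) (T n m f) \<and> open_map (S m) (S n) (T n m f)) \<and>
     (\<forall>n m k. \<forall>f \<in> {..<n} \<rightarrow>\<^sub>E {..<m}. \<forall>g \<in> {..<m} \<rightarrow>\<^sub>E {..<k}. \<forall>p \<in> topspace (S k).
        T n k (compose {..<n} g f) p = T n m f (T m k g p)) \<and>
     (\<forall>n. \<forall>p \<in> topspace (S n). T n n (incl n) p = p) \<and>
     weak_amalgamation S T"

definition omega_space :: "(nat \<Rightarrow> 'a topology) \<Rightarrow> 'a type_maps \<Rightarrow> (nat \<Rightarrow> 'a) topology" where
  "omega_space S T = subtopology (product_topology S UNIV)
     {a. (\<forall>n. a n \<in> topspace (S n)) \<and> (\<forall>n m. n < m \<longrightarrow> a n = T n m (incl n) (a m))}"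

text \<open>
  The map \<open>Sf\<close> on \<open>omega_space S T\<close>, for \<open>f : n \<rightarrow> \<omega>\<close> (extensional on \<open>{..<n}\<close>). Any \<open>m\<close> with
  \<open>f[n] \<subseteq> m\<close> gives the same value, see \<open>omega_map_eq\<close> below; we take the least one.
\<close>

definition omega_map :: "'a type_maps \<Rightarrow> nat \<Rightarrow> (nat \<Rightarrow> nat) \<Rightarrow> (nat \<Rightarrow> 'a) \<Rightarrow> 'a" where
  "omega_map T n f a = (let m = (LEAST m. f ` {..<n} \<subseteq> {..<m}) in T n m f (a m))"

lemma omega_map_eq:
  assumes S: "type_space_functor S T" and a: "a \<in> topspace (omega_space S T)"
    and f: "f \<in> {..<n} \<rightarrow>\<^sub>E {..<m}"
  shows "omega_map T n f a = T n m f (a m)"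
proof -
  define k where "k = (LEAST m. f ` {..<n} \<subseteq> {..<m})"
  have fm: "f ` {..<n} \<subseteq> {..<m}"
    using f by blast
  have fk: "f ` {..<n} \<subseteq> {..<k}"
    unfolding k_def by (rule LeastI[of "\<lambda>m. f ` {..<n} \<subseteq> {..<m}", OF fm])
  have "k \<le> m"
    unfolding k_def using fm by (rule Least_le)
  have fk': "f \<in> {..<n} \<rightarrow>\<^sub>E {..<k}"
    using f fk by (auto simp: PiE_def)
  have a1: "a m \<in> topspace (S m)" and a2: "\<And>n m. n < m \<Longrightarrow> a n = T n m (incl n) (a m)"
    using a by (auto simp: omega_space_def)
  have "T n k f (a k) = T n m f (a m)"
  proof (cases "k = m")
    case False
    with \<open>k \<le> m\<close> have "k < m" by simp
    have "incl k \<in> {..<k} \<rightarrow>\<^sub>E {..<m}"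
      using \<open>k \<le> m\<close> by (auto simp: incl_def)
    then have "T n m (compose {..<n} (incl k) f) (a m) = T n k f (T k m (incl k) (a m))"
      using S fk' a1 unfolding type_space_functor_def by blast
    moreover have "compose {..<n} (incl k) f = f"
    proof
      fix x show "compose {..<n} (incl k) f x = f x"
        using fk' by (cases "x < n") (auto simp: compose_def incl_def PiE_def extensional_def)
    qed
    ultimately show ?thesis
      using a2[OF \<open>k < m\<close>] by simp
  qed simp
  then show ?thesis
    by (simp add: omega_map_def k_def[symmetric])
qed


section \<open>Models of size \<open>\<omega>\<close>\<close>

text \<open>The increasing enumeration of a finite set \<open>A\<close>.\<close>

definition enum_set :: "nat set \<Rightarrow> nat \<Rightarrow> nat" where
  "enum_set A = (\<lambda>i\<in>{..<card A}. sorted_list_of_set A ! i)"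

text \<open>
  In the last clause, \<open>U\<close> is a non-empty, relatively open subset of the fibre; without
  non-emptiness the clause could never hold.
\<close>

definition omega_model :: "(nat \<Rightarrow> 'a topology) \<Rightarrow> 'a type_maps \<Rightarrow> (nat set \<Rightarrow> 'a) \<Rightarrow> bool" where
  "omega_model S T M \<longleftrightarrow>
     (\<forall>A. finite A \<longrightarrow>
        M A \<in> topspace (S (card A)) \<and>
        (\<forall>B g. finite B \<and> A \<subseteq> B \<and> g \<in> {..<card A} \<rightarrow>\<^sub>E {..<card B} \<and>
           (\<forall>i<card A. enum_set A i = enum_set B (g i)) \<longrightarrow>
           M A = T (card A) (card B) g (M B)) \<and>
        (\<forall>m\<ge>card A. \<forall>U. openin (fibre_space S T (card A) m (M A)) U \<and> U \<noteq> {} \<longrightarrow>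
           (\<exists>B g. finite B \<and> card B = m \<and> A \<subseteq> B \<and>
              g \<in> {..<m} \<rightarrow>\<^sub>E {..<m} \<and> bij_betw g {..<m} {..<m} \<and>
              (\<forall>i<card A. enum_set A i = enum_set B (g i)) \<and>
              T m m g (M B) \<in> U)))"

definition model_of :: "'a type_maps \<Rightarrow> (nat \<Rightarrow> 'a) \<Rightarrow> nat set \<Rightarrow> 'a" where
  "model_of T \<sigma> A = omega_map T (card A) (enum_set A) \<sigma>"

definition model_types :: "(nat \<Rightarrow> 'a topology) \<Rightarrow> 'a type_maps \<Rightarrow> (nat \<Rightarrow> 'a) set" where
  "model_types S T = {\<sigma> \<in> topspace (omega_space S T). omega_model S T (model_of T \<sigma>)}"

definition enough_countable_models :: "(nat \<Rightarrow> 'a topology) \<Rightarrow> 'a type_maps \<Rightarrow> bool" where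
  "enough_countable_models S T \<longleftrightarrow>
     omega_space S T closure_of model_types S T = topspace (omega_space S T)"


section \<open>Infinite games\<close>

text \<open>
  Two players alternately choose moves, and the first player makes the moves with even index.
  \<open>legal p\<close> says that all moves in the finite position \<open>p\<close> obey the rules, and \<open>win\<close> is the set of
  infinite plays won by the second player. A strategy \<open>s\<close> is winning for the second player if, as
  long as the first player obeys the rules, it always yields a legal answer, and if every infinite
  legal play following it is won. If the first player has no legal first move at all, then the
  second player wins vacuously; this concerns the empty space in the Banach--Mazur game, and a type
  \<open>C\<close> realized in no model in the omitting types game. In both games a player can always repeat the
  previous move, so no player gets stuck later.
\<close>

definition winning_strategy_second ::
  "('m list \<Rightarrow> bool) \<Rightarrow> (nat \<Rightarrow> 'm) set \<Rightarrow> ('m list \<Rightarrow> 'm) \<Rightarrow> bool" where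
  "winning_strategy_second legal win s \<longleftrightarrow>
     (\<forall>p. legal p \<and> odd (length p) \<and> (\<forall>i<length p. odd i \<longrightarrow> p ! i = s (take i p)) \<longrightarrow>
        legal (p @ [s p])) \<and>
     (\<forall>x. (\<forall>n. legal (map x [0..<n])) \<and> (\<forall>i. odd i \<longrightarrow> x i = s (map x [0..<i])) \<longrightarrow> x \<in> win)"

definition second_player_wins :: "('m list \<Rightarrow> bool) \<Rightarrow> (nat \<Rightarrow> 'm) set \<Rightarrow> bool" where
  "second_player_wins legal win \<longleftrightarrow> (\<exists>s. winning_strategy_second legal win s)"

subsection \<open>The Banach--Mazur game\<close>

definition banach_mazur_legal :: "'b topology \<Rightarrow> 'b set list \<Rightarrow> bool" where
  "banach_mazur_legal Y p \<longleftrightarrow>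
     (\<forall>i<length p. openin Y (p ! i) \<and> p ! i \<noteq> {}) \<and>
     (\<forall>i. Suc i < length p \<longrightarrow> p ! Suc i \<subseteq> p ! i)"

text \<open>The first player is EMPTY, the second player is NONEMPTY.\<close>

definition weakly_alpha_favourable :: "'b topology \<Rightarrow> bool" where
  "weakly_alpha_favourable Y \<longleftrightarrow>
     second_player_wins (banach_mazur_legal Y) {x. (\<Inter>n. x n) \<noteq> {}}"

definition completely_weakly_alpha_favourable :: "'b topology \<Rightarrow> bool" where
  "completely_weakly_alpha_favourable Y \<longleftrightarrow>
     (\<forall>D. closedin Y D \<longrightarrow> weakly_alpha_favourable (subtopology Y D))"

subsection \<open>The omitting types game\<close>

definition partial_omega_type ::
  "(nat \<Rightarrow> 'a topology) \<Rightarrow> 'a type_maps \<Rightarrow> (nat \<Rightarrow> 'a) set \<Rightarrow> bool" where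
  "partial_omega_type S T C \<longleftrightarrow> closedin (omega_space S T) C"

definition omissible ::
  "(nat \<Rightarrow> 'a topology) \<Rightarrow> 'a type_maps \<Rightarrow> (nat \<Rightarrow> 'a) set \<Rightarrow> (nat \<Rightarrow> 'a) set \<Rightarrow> bool" where
  "omissible S T C F \<longleftrightarrow> (\<exists>\<sigma> \<in> model_types S T \<inter> C. \<sigma> \<notin> F)"

definition omitting_legal ::
  "(nat \<Rightarrow> 'a topology) \<Rightarrow> 'a type_maps \<Rightarrow> (nat \<Rightarrow> 'a) set \<Rightarrow> (nat \<Rightarrow> 'a) set list \<Rightarrow> bool" where
  "omitting_legal S T C p \<longleftrightarrow>
     (\<forall>i<length p. partial_omega_type S T (p ! i) \<and> omissible S T C (p ! i)) \<and>
     (\<forall>i. Suc i < length p \<longrightarrow> p ! i \<subseteq> p ! Suc i)"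

text \<open>The first player is REALIZE, the second player is OMIT.\<close>

definition game_omitting_types_property :: "(nat \<Rightarrow> 'a topology) \<Rightarrow> 'a type_maps \<Rightarrow> bool" where
  "game_omitting_types_property S T \<longleftrightarrow>
     (\<forall>C. partial_omega_type S T C \<longrightarrow>
        second_player_wins (omitting_legal S T C) {x. omissible S T C (\<Union>n. x n)})"

end

theory Submission
  imports Defs
begin

text \<open>
  The set of types realizing a model is a \<open>G\<^sub>\<delta>\<close> set \<open>W = (\<Inter>i. G i)\<close> in \<open>S\<^sub>\<omega>\<close>: since each \<open>S n\<close> has a
  countable base and the maps \<open>S\<iota>\<close> are open, each instance of the last clause in the definition of
  a model says that \<open>\<sigma>\<close> lies in the union of a closed and an open set. Given a partial type \<open>C\<close>, let
  \<open>D\<close> be the closure of \<open>W \<inter> C\<close>, so that \<open>W\<close> is dense in \<open>D\<close>. A move \<open>F\<close> in the omitting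
  types game corresponds to the move \<open>D - F\<close> in the Banach--Mazur game on \<open>D\<close>. OMIT follows a winning
  strategy of NONEMPTY, pretending that the move \<open>F (2 * i)\<close> of REALIZE was the open
  set \<open>(D - F (2 * i)) \<inter> G i\<close>. The point obtained in the end lies in \<open>D \<inter> W\<close> and outside every \<open>F n\<close>.
\<close>

section \<open>Countable bases in metric spaces\<close>

lemma separable_metrizable_imp_second_countable:
  assumes "metrizable_space X" and "separable_space X"
  shows "second_countable X"
proof -
  obtain M d where "Metric_space M d" and X: "X = Metric_space.mtopology M d"
    using assms(1) by (auto simp: metrizable_space_def)
  then interpret Metric_space M d by simp
  obtain C where C: "countable C" "C \<subseteq> M" "mtopology closure_of C = M"
    using assms(2) by (auto simp: separable_space_def X)
  \<comment> \<open>The base consists of balls about the points of the dense set. If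
    \<open>c\<close> is closer to \<open>x\<close> than a radius below \<open>r / 2\<close>, the
    ball about \<open>c\<close> of that radius contains \<open>x\<close> and, by the triangle
    inequality, stays in the \<open>r\<close>-ball about \<open>x\<close>.\<close>
  define B where "B = (\<lambda>(c, n). mball c (inverse (real (Suc n)))) ` (C \<times> UNIV)"
  have "\<exists>V\<in>B. x \<in> V \<and> V \<subseteq> U" if U: "openin mtopology U" and x: "x \<in> U" for U x
  proof -
    obtain r where r: "r > 0" "mball x r \<subseteq> U" and xM: "x \<in> M"
      using U x unfolding openin_mtopology by blast
    obtain n where n: "inverse (real (Suc n)) < r / 2"
      using reals_Archimedean[of "r / 2"] r by auto
    have "x \<in> mtopology closure_of C"
      using C xM by simp
    then obtain c where c: "c \<in> C" "c \<in> mball x (inverse (real (Suc n)))"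
      unfolding metric_closure_of using inverse_Suc[of n] by blast
    have "x \<in> mball c (inverse (real (Suc n)))"
      using c by (auto simp: in_mball commute)
    moreover have "mball c (inverse (real (Suc n))) \<subseteq> mball x r"
      by (rule mball_subset) (use c n xM commute[of c x] in auto)
    ultimately show ?thesis
      using c(1) r(2) unfolding B_def
      by (intro bexI[of _ "mball c (inverse (real (Suc n)))"] conjI rev_image_eqI[of "(c, n)"]) auto
  qed
  moreover have "countable B" "\<forall>V\<in>B. openin mtopology V"
    using C by (auto simp: B_def)
  ultimately show ?thesis
    by (auto simp: second_countable_def X)
qed


section \<open>The structure coded by a point of the limit space\<close>

lemma incl_PiE: "n \<le> m \<Longrightarrow> incl n \<in> {..<n} \<rightarrow>\<^sub>E {..<m}"
  by (auto simp: incl_def)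

lemma enum_set_PiE:
  assumes "finite A" and "A \<subseteq> {..<m}"
  shows "enum_set A \<in> {..<card A} \<rightarrow>\<^sub>E {..<m}"
proof -
  have "sorted_list_of_set A ! i \<in> A" if "i < card A" for i
    using nth_mem[of i "sorted_list_of_set A"] assms(1) that by simp
  then show ?thesis
    using assms(2) by (auto simp: enum_set_def)
qed

text \<open>The index set of the product is countable. Metrizability is what later makes closed sets
  of types G-delta.\<close>

lemma metrizable_omega_space:
  assumes "\<And>n. metrizable_space (S n)"
  shows "metrizable_space (omega_space S T)"
  unfolding omega_space_def
  by (intro metrizable_space_subtopology) (simp add: metrizable_space_product_topology assms)

context
  fixes S :: "nat \<Rightarrow> 'a topology" and T :: "'a type_maps"
  assumes functor_S: "type_space_functor S T"
begin

lemma continuous_map_T: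
  "f \<in> {..<n} \<rightarrow>\<^sub>E {..<m} \<Longrightarrow> continuous_map (S m) (S n) (T n m f)"
  using functor_S by (simp add: type_space_functor_def)

lemma open_map_T:
  "f \<in> {..<n} \<rightarrow>\<^sub>E {..<m} \<Longrightarrow> open_map (S m) (S n) (T n m f)"
  using functor_S by (simp add: type_space_functor_def)

lemma T_compose:
  assumes "f \<in> {..<n} \<rightarrow>\<^sub>E {..<m}" "g \<in> {..<m} \<rightarrow>\<^sub>E {..<k}" "p \<in> topspace (S k)"
  shows "T n m f (T m k g p) = T n k (compose {..<n} g f) p"
  using functor_S assms unfolding type_space_functor_def by metis

lemma T_in_topspace:
  "f \<in> {..<n} \<rightarrow>\<^sub>E {..<m} \<Longrightarrow> p \<in> topspace (S m) \<Longrightarrow> T n m f p \<in> topspace (S n)"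
  using continuous_map_funspace[OF continuous_map_T] by (rule funcset_mem)

lemma omega_space_nth: "\<sigma> \<in> topspace (omega_space S T) \<Longrightarrow> \<sigma> m \<in> topspace (S m)"
  by (auto simp: omega_space_def)

lemma model_of_eq:
  assumes "\<sigma> \<in> topspace (omega_space S T)" "finite A" "A \<subseteq> {..<m}"
  shows "model_of T \<sigma> A = T (card A) m (enum_set A) (\<sigma> m)"
  unfolding model_of_def using omega_map_eq[OF functor_S assms(1) enum_set_PiE[OF assms(2,3)]] .

text \<open>A finite \<open>A\<close> lies below some \<open>m\<close>, so the map is the projection
  to coordinate \<open>m\<close> followed by a single continuous \<open>T\<close>.\<close>

lemma continuous_map_model_of:
  assumes "finite A"
  shows "continuous_map (omega_space S T) (S (card A)) (\<lambda>\<sigma>. model_of T \<sigma> A)"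
proof -
  obtain m where m: "A \<subseteq> {..<m}"
    using assms finite_nat_iff_bounded by blast
  have "continuous_map (omega_space S T) (S m) (\<lambda>\<sigma>. \<sigma> m)"
    unfolding omega_space_def
    by (intro continuous_map_from_subtopology continuous_map_product_projection) simp
  from continuous_map_compose[OF this continuous_map_T[OF enum_set_PiE[OF assms m]]]
  show ?thesis
    by (rule continuous_map_eq) (simp add: model_of_eq[OF _ assms m])
qed

lemma model_of_in_topspace:
  "\<sigma> \<in> topspace (omega_space S T) \<Longrightarrow> finite A \<Longrightarrow> model_of T \<sigma> A \<in> topspace (S (card A))"
  using funcset_mem[OF continuous_map_funspace[OF continuous_map_model_of]] .

text \<open>For \<open>m\<close> bounding \<open>B\<close>, both sides are images of the one
  coordinate \<open>\<sigma> m\<close>, and functoriality compares them. Hence the compatibility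
  clause of a model holds at every point of the limit space, and only the last clause restricts
  \<open>\<sigma>\<close>.\<close>

lemma model_of_restrict:
  assumes \<sigma>: "\<sigma> \<in> topspace (omega_space S T)" and "finite B" "A \<subseteq> B"
    and g: "g \<in> {..<card A} \<rightarrow>\<^sub>E {..<card B}"
    and eq: "\<And>i. i < card A \<Longrightarrow> enum_set A i = enum_set B (g i)"
  shows "model_of T \<sigma> A = T (card A) (card B) g (model_of T \<sigma> B)"
proof -
  obtain m where m: "B \<subseteq> {..<m}"
    using assms finite_nat_iff_bounded by blast
  have A: "finite A" "A \<subseteq> {..<m}"
    using assms m by (auto intro: finite_subset)
  have "compose {..<card A} (enum_set B) g = enum_set A"
    using eq enum_set_PiE[OF A] by (auto simp: compose_def PiE_def extensional_def fun_eq_iff)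
  then show ?thesis
    using model_of_eq[OF \<sigma> A] model_of_eq[OF \<sigma> \<open>finite B\<close> m]
      T_compose[OF g enum_set_PiE[OF \<open>finite B\<close> m] omega_space_nth[OF \<sigma>]] by simp
qed

text \<open>
  By openness of \<open>S\<iota>\<close>, the condition that \<open>V\<close> meets the fibre over \<open>M\<^sub>\<sigma>(A)\<close> is open in \<open>\<sigma>\<close>; this
  is what turns the quantification over subsets of a varying fibre into one over a fixed base.
\<close>

lemma omega_model_model_of_iff:
  assumes \<sigma>: "\<sigma> \<in> topspace (omega_space S T)"
    and Bopen: "\<And>m V. V \<in> \<B> m \<Longrightarrow> openin (S m) V"
    and Bbase: "\<And>m U x. openin (S m) U \<Longrightarrow> x \<in> U \<Longrightarrow> \<exists>V\<in>\<B> m. x \<in> V \<and> V \<subseteq> U"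
  shows "omega_model S T (model_of T \<sigma>) \<longleftrightarrow>
    (\<forall>A m. finite A \<and> card A \<le> m \<longrightarrow>
       (\<forall>V\<in>\<B> m. model_of T \<sigma> A \<in> T (card A) m (incl (card A)) ` V \<longrightarrow>
         (\<exists>B g. finite B \<and> card B = m \<and> A \<subseteq> B \<and>
            g \<in> {..<m} \<rightarrow>\<^sub>E {..<m} \<and> bij_betw g {..<m} {..<m} \<and>
            (\<forall>i<card A. enum_set A i = enum_set B (g i)) \<and>
            T m m g (model_of T \<sigma> B) \<in> V)))"
    (is "_ \<longleftrightarrow> ?R")
proof
  assume M: "omega_model S T (model_of T \<sigma>)"
  show ?R
  proof (intro allI impI ballI)
    fix A m V
    assume A: "finite A \<and> card A \<le> m" and V: "V \<in> \<B> m"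
      and im: "model_of T \<sigma> A \<in> T (card A) m (incl (card A)) ` V"
    define U where "U = {q \<in> topspace (S m). T (card A) m (incl (card A)) q = model_of T \<sigma> A} \<inter> V"
    have "openin (fibre_space S T (card A) m (model_of T \<sigma> A)) U"
      unfolding fibre_space_def U_def using Bopen[OF V] by (rule openin_subtopology_Int2)
    moreover have "U \<noteq> {}"
      using im openin_subset[OF Bopen[OF V]] by (auto simp: U_def)
    ultimately obtain B g where "finite B \<and> card B = m \<and> A \<subseteq> B \<and>
            g \<in> {..<m} \<rightarrow>\<^sub>E {..<m} \<and> bij_betw g {..<m} {..<m} \<and>
            (\<forall>i<card A. enum_set A i = enum_set B (g i)) \<and>
            T m m g (model_of T \<sigma> B) \<in> U"
      using M A unfolding omega_model_def by meson
    then show "\<exists>B g. finite B \<and> card B = m \<and> A \<subseteq> B \<and>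
            g \<in> {..<m} \<rightarrow>\<^sub>E {..<m} \<and> bij_betw g {..<m} {..<m} \<and>
            (\<forall>i<card A. enum_set A i = enum_set B (g i)) \<and>
            T m m g (model_of T \<sigma> B) \<in> V"
      unfolding U_def by blast
  qed
next
  assume R: ?R
  show "omega_model S T (model_of T \<sigma>)"
    unfolding omega_model_def
  proof (intro allI impI conjI)
    fix A :: "nat set" assume A: "finite A"
    show "model_of T \<sigma> A \<in> topspace (S (card A))"
      by (rule model_of_in_topspace[OF \<sigma> A])
    show "model_of T \<sigma> A = T (card A) (card B) g (model_of T \<sigma> B)"
      if "finite B \<and> A \<subseteq> B \<and> g \<in> {..<card A} \<rightarrow>\<^sub>E {..<card B} \<and>
           (\<forall>i<card A. enum_set A i = enum_set B (g i))" for B g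
      using that by (intro model_of_restrict[OF \<sigma>]) auto
    fix m U
    assume m: "card A \<le> m"
      and U: "openin (fibre_space S T (card A) m (model_of T \<sigma> A)) U \<and> U \<noteq> {}"
    \<comment> \<open>An arbitrary \<open>U\<close> is the trace on the fibre of an open
      \<open>W\<close>; a basic \<open>V\<close> inside \<open>W\<close> around a point of
      \<open>U\<close> meets the fibre, so the hypothesis applies to \<open>V\<close>.\<close>
    obtain W where W: "openin (S m) W"
      and UW: "U = W \<inter> {q \<in> topspace (S m). T (card A) m (incl (card A)) q = model_of T \<sigma> A}"
      using U by (auto simp: fibre_space_def openin_subtopology)
    obtain x where x: "x \<in> U"
      using U by blast
    obtain V where V: "V \<in> \<B> m" "x \<in> V" "V \<subseteq> W"
      using Bbase[OF W, of x] x UW by blast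
    have "model_of T \<sigma> A \<in> T (card A) m (incl (card A)) ` V"
      using x unfolding UW by (intro image_eqI[OF _ V(2)]) simp
    then obtain B g where B: "finite B" "card B = m" "A \<subseteq> B"
      and g: "g \<in> {..<m} \<rightarrow>\<^sub>E {..<m}" "bij_betw g {..<m} {..<m}"
      and eq: "\<forall>i<card A. enum_set A i = enum_set B (g i)"
      and in_V: "T m m g (model_of T \<sigma> B) \<in> V"
      using R A m V(1) by meson
    have MB: "model_of T \<sigma> B \<in> topspace (S m)"
      using model_of_in_topspace[OF \<sigma> B(1)] B(2) by simp
    \<comment> \<open>The point found lies in \<open>V\<close>, but it must also lie in the fibre.
      On indices below \<open>card A\<close>, \<open>g\<close> already matches \<open>A\<close> with
      \<open>B\<close>, so compatibility of the model puts it there.\<close>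
    have "compose {..<card A} g (incl (card A)) \<in> {..<card A} \<rightarrow>\<^sub>E {..<card B}"
      using PiE_mem[OF g(1)] m B(2) by (intro PiE_I) (simp_all add: compose_def incl_def)
    then have "model_of T \<sigma> A =
        T (card A) (card B) (compose {..<card A} g (incl (card A))) (model_of T \<sigma> B)"
      by (rule model_of_restrict[OF \<sigma> B(1,3)]) (use eq in \<open>simp add: compose_def incl_def\<close>)
    then have "T (card A) m (incl (card A)) (T m m g (model_of T \<sigma> B)) = model_of T \<sigma> A"
      using T_compose[OF incl_PiE[OF m] g(1) MB] B(2) by simp
    then have "T m m g (model_of T \<sigma> B) \<in> U"
      using in_V V T_in_topspace[OF g(1) MB] by (auto simp: UW)
    then show "\<exists>B g. finite B \<and> card B = m \<and> A \<subseteq> B \<and>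
            g \<in> {..<m} \<rightarrow>\<^sub>E {..<m} \<and> bij_betw g {..<m} {..<m} \<and>
            (\<forall>i<card A. enum_set A i = enum_set B (g i)) \<and>
            T m m g (model_of T \<sigma> B) \<in> U"
      using B g eq by blast
  qed
qed

section \<open>Descriptive complexity of the set of model types\<close>

lemma gdelta_in_model_types:
  assumes sep: "\<And>n. separable_space (S n)" and met: "\<And>n. metrizable_space (S n)"
  shows "gdelta_in (omega_space S T) (model_types S T)"
proof -
  let ?X = "omega_space S T"
  obtain \<B> where \<B>: "\<And>m. countable (\<B> m)" "\<And>m V. V \<in> \<B> m \<Longrightarrow> openin (S m) V"
    "\<And>m U x. openin (S m) U \<Longrightarrow> x \<in> U \<Longrightarrow> \<exists>V\<in>\<B> m. x \<in> V \<and> V \<subseteq> U"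
    using separable_metrizable_imp_second_countable[OF met sep]
    unfolding second_countable_def by metis
  define Q where "Q A m = {(B, g). finite B \<and> card B = m \<and> A \<subseteq> B \<and>
            g \<in> {..<m} \<rightarrow>\<^sub>E {..<m} \<and> bij_betw g {..<m} {..<m} \<and>
            (\<forall>i<card A. enum_set A i = enum_set B (g i))}" for A m
  define P where "P A m V = {\<sigma> \<in> topspace ?X. model_of T \<sigma> A \<in> T (card A) m (incl (card A)) ` V}"
    for A m V
  \<comment> \<open>One instance of the last clause, an implication, becomes the complement of its
    open premise united with its open conclusion.\<close>
  define E where "E = (\<lambda>(A, m, V). (topspace ?X - P A m V) \<union>
      (\<Union>(B, g) \<in> Q A m. {\<sigma> \<in> topspace ?X. T m m g (model_of T \<sigma> B) \<in> V}))"
  define I where "I = (SIGMA A : {A :: nat set. finite A}. SIGMA m : {card A..}. \<B> m)"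
  have "gdelta_in ?X (E (A, m, V))" if i: "(A, m, V) \<in> I" for A m V
  proof -
    have A: "finite A" "card A \<le> m" and V: "openin (S m) V"
      using i \<B> by (auto simp: I_def)
    have "openin (S (card A)) (T (card A) m (incl (card A)) ` V)"
      using open_map_T[OF incl_PiE[OF A(2)]] V by (auto simp: open_map_def)
    then have "openin ?X (P A m V)"
      unfolding P_def by (rule openin_continuous_map_preimage[OF continuous_map_model_of[OF A(1)]])
    then have "gdelta_in ?X (topspace ?X - P A m V)"
      by (intro closed_imp_gdelta_in metrizable_omega_space met) blast
    moreover have "openin ?X {\<sigma> \<in> topspace ?X. T m m g (model_of T \<sigma> B) \<in> V}"
      if "(B, g) \<in> Q A m" for B g
    proof -
      have B: "finite B" "card B = m" and g: "g \<in> {..<m} \<rightarrow>\<^sub>E {..<m}"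
        using that by (auto simp: Q_def)
      have "continuous_map ?X (S m) (\<lambda>\<sigma>. model_of T \<sigma> B)"
        using continuous_map_model_of[OF B(1)] B(2) by simp
      from continuous_map_compose[OF this continuous_map_T[OF g]]
      show ?thesis
        using openin_continuous_map_preimage[OF _ V] by fastforce
    qed
    then have "openin ?X (\<Union>(B, g) \<in> Q A m. {\<sigma> \<in> topspace ?X. T m m g (model_of T \<sigma> B) \<in> V})"
      by (intro openin_Union) auto
    ultimately show ?thesis
      unfolding E_def by (simp add: gdelta_in_Un open_imp_gdelta_in)
  qed
  moreover have "countable I"
    unfolding I_def using \<B>(1) by (intro countable_SIGMA countable_Collect_finite) auto
  \<comment> \<open>Inserting the whole space keeps the intersected family nonempty even if there
    are no indices.\<close>
  ultimately have "gdelta_in ?X (\<Inter> (insert (topspace ?X) (E ` I)))"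
    by (intro gdelta_in_Inter) auto
  moreover have "\<Inter> (insert (topspace ?X) (E ` I)) = model_types S T"
  proof (rule set_eqI)
    fix \<sigma>
    show "\<sigma> \<in> \<Inter> (insert (topspace ?X) (E ` I)) \<longleftrightarrow> \<sigma> \<in> model_types S T"
    proof (cases "\<sigma> \<in> topspace ?X")
      case True
      have "\<sigma> \<in> \<Inter> (insert (topspace ?X) (E ` I)) \<longleftrightarrow>
          (\<forall>A m. finite A \<and> card A \<le> m \<longrightarrow> (\<forall>V\<in>\<B> m. \<sigma> \<in> E (A, m, V)))"
        using True unfolding I_def by (simp add: Ball_def) blast
      moreover have "\<sigma> \<in> E (A, m, V) \<longleftrightarrow> (model_of T \<sigma> A \<in> T (card A) m (incl (card A)) ` V \<longrightarrow>
          (\<exists>B g. (B, g) \<in> Q A m \<and> T m m g (model_of T \<sigma> B) \<in> V))" for A m V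
        using True unfolding E_def P_def by (simp add: Bex_def)
      ultimately show ?thesis
        using True omega_model_model_of_iff[OF True \<B>(2,3)]
        by (simp only: model_types_def mem_Collect_eq Q_def case_prod_conv conj_assoc simp_thms)
    qed (simp add: model_types_def)
  qed
  ultimately show ?thesis
    by simp
qed

end


section \<open>Transferring the strategy\<close>

text \<open>This form of legality suits the induction that builds a play one move at a time.\<close>

lemma banach_mazur_legal_snoc:
  "banach_mazur_legal Y (p @ [U]) \<longleftrightarrow>
     banach_mazur_legal Y p \<and> openin Y U \<and> U \<noteq> {} \<and> (p \<noteq> [] \<longrightarrow> U \<subseteq> last p)"
proof -
  have "banach_mazur_legal Y q \<longleftrightarrow>
      (\<forall>U\<in>set q. openin Y U \<and> U \<noteq> {}) \<and> successively (\<lambda>U V. V \<subseteq> U) q" for q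
    by (simp add: banach_mazur_legal_def all_set_conv_all_nth successively_conv_nth)
  then show ?thesis
    by (auto simp: successively_append_iff)
qed

lemma omitting_legal_snoc:
  "omitting_legal S T C (p @ [F]) \<longleftrightarrow>
     omitting_legal S T C p \<and> closedin (omega_space S T) F \<and> omissible S T C F \<and>
     (p \<noteq> [] \<longrightarrow> last p \<subseteq> F)"
proof -
  have "omitting_legal S T C q \<longleftrightarrow>
      (\<forall>F\<in>set q. closedin (omega_space S T) F \<and> omissible S T C F) \<and> successively (\<subseteq>) q" for q
    by (simp add: omitting_legal_def partial_omega_type_def all_set_conv_all_nth
        successively_conv_nth)
  then show ?thesis
    by (auto simp: successively_append_iff)
qed

lemma omitting_second_player_wins:
  assumes C: "closedin (omega_space S T) C"
    and W: "gdelta_in (omega_space S T) (model_types S T)"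
    and fav: "completely_weakly_alpha_favourable (omega_space S T)"
  shows "second_player_wins (omitting_legal S T C) {x. omissible S T C (\<Union>n. x n)}"
proof -
  let ?X = "omega_space S T" and ?W = "model_types S T"
  obtain G :: "nat \<Rightarrow> (nat \<Rightarrow> 'a) set"
    where G: "\<And>n. openin ?X (G n)" and WG: "\<Inter> (range G) = ?W"
    using W by (auto simp: gdelta_in_descending)
  define D where "D = ?X closure_of (?W \<inter> C)"
  let ?Y = "subtopology ?X D"
  have D: "closedin ?X D"
    by (simp add: D_def)
  have DC: "D \<subseteq> C"
    unfolding D_def by (intro closure_of_minimal C) simp
  have WCD: "?W \<inter> C \<subseteq> D"
    unfolding D_def by (intro closure_of_subset) (auto simp: model_types_def)
  \<comment> \<open>Density of the realized types in \<open>D\<close> ensures that a closed set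
    avoiding a nonempty relatively open part of \<open>D\<close> is omissible.\<close>
  have meets: "\<exists>\<sigma>\<in>U. \<sigma> \<in> ?W \<inter> C" if "openin ?Y U" "U \<noteq> {}" for U
  proof -
    obtain V where V: "openin ?X V" "U = V \<inter> D"
      using \<open>openin ?Y U\<close> by (metis openin_subtopology)
    then obtain x where "x \<in> V" "x \<in> D"
      using \<open>U \<noteq> {}\<close> by blast
    then obtain y where "y \<in> V" "y \<in> ?W \<inter> C"
      using V(1) unfolding D_def in_closure_of by blast
    then show ?thesis
      using WCD \<open>U = V \<inter> D\<close> by blast
  qed
  obtain t where t: "winning_strategy_second (banach_mazur_legal ?Y) {x. (\<Inter>n. x n) \<noteq> {}} t"
    using fav D unfolding completely_weakly_alpha_favourable_def weakly_alpha_favourable_def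
      second_player_wins_def by blast
  \<comment> \<open>Only even moves, those of REALIZE, are cut down; halving the index makes move
    \<open>2 * n\<close> use \<open>G n\<close>, so every \<open>G n\<close> occurs. Odd moves stay
    uncut so that they can reproduce the answers of \<open>t\<close> exactly.\<close>
  define b where "b i F = (if even i then (D - F) \<inter> G (i div 2) else D - F)" for i :: nat and F
  define q where "q p = map (\<lambda>i. b i (p ! i)) [0..<length p]" for p
  \<comment> \<open>OMIT adds every point of \<open>D\<close> that the answer of NONEMPTY
    discards.\<close>
  define s where "s p = last p \<union> (D - t (q p))" for p
  have length_q [simp]: "length (q p) = length p" for p
    by (simp add: q_def)
  have q_eq_Nil [simp]: "q p = [] \<longleftrightarrow> p = []" for p
    by (simp add: q_def)
  have nth_q [simp]: "i < length p \<Longrightarrow> q p ! i = b i (p ! i)" for i p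
    by (simp add: q_def)
  have last_q: "last (q p) = b (length p - 1) (last p)" if "p \<noteq> []" for p
    using that by (simp add: last_conv_nth)
  have b_sub: "b i F \<subseteq> D - F" for i F
    by (auto simp: b_def)
  have t_legal: "banach_mazur_legal ?Y (r @ [t r])"
    if "banach_mazur_legal ?Y r" "odd (length r)"
      "\<And>i. i < length r \<Longrightarrow> odd i \<Longrightarrow> r ! i = t (take i r)" for r
    using t that unfolding winning_strategy_second_def by blast
  \<comment> \<open>The invariant of the simulation: plays following \<open>s\<close> translate to
    plays following \<open>t\<close>.\<close>
  have q_legal: "banach_mazur_legal ?Y (q p) \<and>
      (\<forall>i<length p. odd i \<longrightarrow> q p ! i = t (take i (q p)))"
    if "omitting_legal S T C p" "\<forall>i<length p. odd i \<longrightarrow> p ! i = s (take i p)" for p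
    using that
  proof (induction p rule: rev_induct)
    case Nil
    then show ?case by (simp add: banach_mazur_legal_def)
  next
    case (snoc F p)
    have "omitting_legal S T C p"
      and F: "closedin ?X F" "omissible S T C F" and last_F: "p \<noteq> [] \<Longrightarrow> last p \<subseteq> F"
      using snoc.prems(1) by (auto simp: omitting_legal_snoc)
    moreover have "\<forall>i<length p. odd i \<longrightarrow> p ! i = s (take i p)"
    proof (intro allI impI)
      fix i assume i: "i < length p" "odd i"
      then have "(p @ [F]) ! i = s (take i (p @ [F]))"
        using snoc.prems(2) by simp
      then show "p ! i = s (take i p)"
        using i by (simp add: nth_append)
    qed
    ultimately have legal: "banach_mazur_legal ?Y (q p)"
      and follows: "\<forall>i<length p. odd i \<longrightarrow> q p ! i = t (take i (q p))"
      using snoc.IH by auto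
    have q_snoc: "q (p @ [F]) = q p @ [b (length p) F]"
      by (simp add: q_def nth_append)
    show ?case
    proof (cases "even (length p)")
      case True
      have "openin ?Y (b (length p) F)"
      proof -
        have "openin ?X (G (length p div 2) - F)"
          by (intro openin_diff G F)
        then have "openin ?Y (D \<inter> (G (length p div 2) - F))"
          by (rule openin_subtopology_Int2)
        moreover have "b (length p) F = D \<inter> (G (length p div 2) - F)"
          using True by (auto simp: b_def)
        ultimately show ?thesis
          by simp
      qed
      \<comment> \<open>A type witnessing that \<open>F\<close> is omissible lies in
        \<open>D\<close> and in every \<open>G n\<close>.\<close>
      moreover have "b (length p) F \<noteq> {}"
        using F(2) WCD WG True by (fastforce simp: omissible_def b_def)
      moreover have "b (length p) F \<subseteq> last (q p)" if "p \<noteq> []"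
      proof -
        \<comment> \<open>The preceding translated move is odd, so it has no \<open>G\<close> factor
          and monotonicity only needs \<open>last p \<subseteq> F\<close>.\<close>
        have "odd (length p - 1)"
          using True that by (cases p) auto
        then show ?thesis
          using last_F[OF that] by (auto simp: last_q[OF that] b_def)
      qed
      ultimately have "banach_mazur_legal ?Y (q p @ [b (length p) F])"
        using legal by (auto simp: banach_mazur_legal_snoc)
      then show ?thesis
        using True follows by (auto simp: q_snoc nth_append less_Suc_eq)
    next
      case False
      then have "p \<noteq> []" by auto
      have t_q: "banach_mazur_legal ?Y (q p @ [t (q p)])"
        using False follows by (intro t_legal legal) auto
      then have t_sub: "t (q p) \<subseteq> last (q p)"
        using \<open>p \<noteq> []\<close> by (auto simp: banach_mazur_legal_snoc)
      have "F = s p"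
        using snoc.prems(2) False by (auto dest!: spec[of _ "length p"])
      \<comment> \<open>The answer of \<open>t\<close> already avoids \<open>last p\<close>, so
        removing \<open>s p\<close> from \<open>D\<close> leaves precisely that answer.\<close>
      then have "b (length p) F = t (q p)"
        using False t_sub b_sub[of "length p - 1" "last p"] \<open>p \<noteq> []\<close>
        by (auto simp: b_def s_def last_q)
      then show ?thesis
        using t_q follows by (auto simp: q_snoc nth_append less_Suc_eq)
    qed
  qed
  have "winning_strategy_second (omitting_legal S T C) {x. omissible S T C (\<Union>n. x n)} s"
    unfolding winning_strategy_second_def
  proof (intro conjI allI impI)
    fix p
    assume p: "omitting_legal S T C p \<and> odd (length p) \<and>
      (\<forall>i<length p. odd i \<longrightarrow> p ! i = s (take i p))"
    then have "p \<noteq> []" by auto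
    have "banach_mazur_legal ?Y (q p @ [t (q p)])"
      using p q_legal[of p] by (intro t_legal) auto
    then have t_open: "openin ?Y (t (q p))" and t_ne: "t (q p) \<noteq> {}"
      and t_sub: "t (q p) \<subseteq> last (q p)"
      using \<open>p \<noteq> []\<close> by (auto simp: banach_mazur_legal_snoc)
    obtain \<sigma> where \<sigma>: "\<sigma> \<in> t (q p)" "\<sigma> \<in> ?W \<inter> C"
      using meets[OF t_open t_ne] by blast
    have "last (q p) \<subseteq> D - last p"
      using b_sub[of "length p - 1" "last p"] last_q[OF \<open>p \<noteq> []\<close>] by simp
    then have "omissible S T C (s p)"
      using \<sigma> t_sub by (auto simp: omissible_def s_def)
    moreover have "closedin ?X (s p)"
    proof -
      \<comment> \<open>Relatively closed in \<open>D\<close>, which is itself closed.\<close>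
      have "closedin ?X (D - t (q p))"
        using t_open D closedin_trans_full
        by (metis closedin_diff closedin_subset closedin_topspace topspace_subtopology_subset)
      moreover have "closedin ?X (last p)"
        using p \<open>p \<noteq> []\<close> by (simp add: omitting_legal_def partial_omega_type_def last_conv_nth)
      ultimately show ?thesis
        unfolding s_def by (intro closedin_Un)
    qed
    moreover have "last p \<subseteq> s p"
      by (simp add: s_def)
    ultimately show "omitting_legal S T C (p @ [s p])"
      using p by (simp add: omitting_legal_snoc)
  next
    fix x :: "nat \<Rightarrow> (nat \<Rightarrow> 'a) set"
    assume x: "(\<forall>n. omitting_legal S T C (map x [0..<n])) \<and>
      (\<forall>i. odd i \<longrightarrow> x i = s (map x [0..<i]))"
    define y where "y i = b i (x i)" for i
    have q_x: "q (map x [0..<n]) = map y [0..<n]" for n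
      by (auto simp: q_def y_def)
    have y: "banach_mazur_legal ?Y (map y [0..<n]) \<and>
        (\<forall>i<n. odd i \<longrightarrow> y i = t (map y [0..<i]))" for n
      using q_legal[of "map x [0..<n]"] x by (simp add: q_x take_map)
    \<comment> \<open>The translated infinite play follows \<open>t\<close>, hence is won by
      NONEMPTY.\<close>
    then have "(\<Inter>n. y n) \<noteq> {}"
      using t lessI unfolding winning_strategy_second_def by blast
    then obtain \<sigma> where \<sigma>: "\<And>n. \<sigma> \<in> y n"
      by blast
    have "\<sigma> \<in> D" "\<sigma> \<notin> x n" for n
      using \<sigma> b_sub[of n "x n"] by (auto simp: y_def)
    moreover have "\<sigma> \<in> ?W"
    proof -
      have "\<sigma> \<in> G n" for n
        using \<sigma>[of "2 * n"] by (simp add: y_def b_def)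
      then show ?thesis
        using WG by blast
    qed
    ultimately show "x \<in> {x. omissible S T C (\<Union>n. x n)}"
      using DC by (auto simp: omissible_def)
  qed
  then show ?thesis
    unfolding second_player_wins_def by blast
qed

theorem theorem2p6:
  fixes S :: "nat \<Rightarrow> 'a topology" and T :: "'a type_maps"
  assumes "type_space_functor S T"
    and "enough_countable_models S T"
    and "\<And>n. separable_space (S n)"
    and "\<And>n. metrizable_space (S n)"
    and "completely_weakly_alpha_favourable (omega_space S T)"
  shows "game_omitting_types_property S T"
  unfolding game_omitting_types_property_def partial_omega_type_def
  using omitting_second_player_wins gdelta_in_model_types assms by blast

end
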